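(* Let $d\in\mathbb{N}$ with $d\ge 3$, let $b$ be a positive $C^1$-function on $[0,\infty)$, let $p>p_1:=1+\frac{4}{d-2}$, let $N(z)=\pm|z|^p$, and let $(u_0,u_1)\in H^1(\mathbb{R}^d)\times L^2(\mathbb{R}^d)$. Assume that $$\pm\bigl(b(0)u_0+u_1\bigr)(x)\ge\begin{cases}|x|^{-k},&\text{if } |x|\le 1,\\ 0,&\text{if } |x|>1,\end{cases}$$ with some $k\in\left(\frac{p+1}{p-1},\frac d2\right)$, where the double sign corresponds to the one in $N$. Then for any $T>0$ there does not exist a weak solution on $[0,T)$ of $$u_{tt}-\Delta u+b(t)u_t=N(u)\ \ (t\in[0,T),\ x\in\mathbb{R}^d),\qquad u(0)=u_0,\quad u_t(0)=u_1.\qquad( * )$$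
   Context: All functions are real-valued. A weak solution of $( * )$ on $[0,T)$ is a function $u\in L^p_{loc}([0,T)\times\mathbb{R}^d)$ such that for every $\psi\in C_0^\infty([0,T)\times\mathbb{R}^d)$, $$\int_{[0,T)\times\mathbb{R}^d}u\{\partial_t^2\psi-\Delta\psi-b'(t)\psi-b(t)\partial_t\psi\}\,dx\,dt=-\int_{\mathbb{R}^d}u_0(x)\,\partial_t\psi(0,x)\,dx+\int_{\mathbb{R}^d}\{b(0)u_0(x)+u_1(x)\}\psi(0,x)\,dx+\int_{[0,T)\times\mathbb{R}^d}N(u)\psi\,dx\,dt.$$ *)

theory Defs
  imports "HOL-Analysis.Analysis"
begin

text \<open>
  Functions on a subset \<open>S\<close> of a Euclidean space are represented by total functions of which only
  the values on \<open>S\<close> matter. Derivatives are therefore taken within \<open>S\<close>; at a boundary point of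
  \<open>S = {0..<T} \<times> UNIV\<close> they are one-sided in time. They are uniquely determined for all sets \<open>S\<close>
  used below.
\<close>

fun Ck_on :: "nat \<Rightarrow> 'a::real_normed_vector set \<Rightarrow> ('a \<Rightarrow> real) \<Rightarrow> bool" where
  "Ck_on 0 S f \<longleftrightarrow> continuous_on S f"
| "Ck_on (Suc k) S f \<longleftrightarrow>
     (\<exists>f'. (\<forall>x\<in>S. (f has_derivative f' x) (at x within S)) \<and> (\<forall>v. Ck_on k S (\<lambda>x. f' x v)))"

definition smooth_on :: "'a::real_normed_vector set \<Rightarrow> ('a \<Rightarrow> real) \<Rightarrow> bool" where
  "smooth_on S f \<longleftrightarrow> (\<forall>k. Ck_on k S f)"

text \<open>
  \<open>C\<^sub>0\<^sup>\<infinity>(S)\<close>. The support must be a compact subset of \<open>S\<close>: for \<open>S = {0..<T} \<times> UNIV\<close> it may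
  touch \<open>t = 0\<close> but stays away from \<open>t = T\<close>.
\<close>

definition test_functions :: "'a::euclidean_space set \<Rightarrow> ('a \<Rightarrow> real) set" where
  "test_functions S = {\<psi>. smooth_on S \<psi> \<and>
     compact (closure (support_on S \<psi>)) \<and> closure (support_on S \<psi>) \<subseteq> S}"

definition dir_deriv ::
    "'a::real_normed_vector set \<Rightarrow> 'a \<Rightarrow> ('a \<Rightarrow> real) \<Rightarrow> 'a \<Rightarrow> real" where
  "dir_deriv S v f x = frechet_derivative f (at x within S) v"

definition L2_space :: "('a::euclidean_space \<Rightarrow> real) set" where
  "L2_space = {f. f \<in> borel_measurable lebesgue \<and> integrable lebesgue (\<lambda>x. (f x)\<^sup>2)}"

definition weak_dir_deriv :: "'a::euclidean_space \<Rightarrow> ('a \<Rightarrow> real) \<Rightarrow> ('a \<Rightarrow> real) \<Rightarrow> bool" where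
  "weak_dir_deriv v f g \<longleftrightarrow>
     (\<forall>\<phi>\<in>test_functions UNIV.
        (LINT x|lebesgue. f x * dir_deriv UNIV v \<phi> x) = - (LINT x|lebesgue. g x * \<phi> x))"

definition H1_space :: "('a::euclidean_space \<Rightarrow> real) set" where
  "H1_space = {f \<in> L2_space. \<forall>e\<in>Basis. \<exists>g\<in>L2_space. weak_dir_deriv e f g}"

definition Lp_loc :: "real \<Rightarrow> 'a::euclidean_space set \<Rightarrow> ('a \<Rightarrow> real) set" where
  "Lp_loc p S = {u. set_borel_measurable lebesgue S u \<and>
     (\<forall>K. compact K \<longrightarrow> K \<subseteq> S \<longrightarrow> set_integrable lebesgue K (\<lambda>z. \<bar>u z\<bar> powr p))}"

abbreviation spacetime :: "real \<Rightarrow> (real \<times> 'a::euclidean_space) set" where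
  "spacetime T \<equiv> {0..<T} \<times> UNIV"

definition time_deriv ::
    "real \<Rightarrow> (real \<times> 'a::euclidean_space \<Rightarrow> real) \<Rightarrow> real \<times> 'a \<Rightarrow> real" where
  "time_deriv T = dir_deriv (spacetime T) (1, 0)"

definition laplacian ::
    "real \<Rightarrow> (real \<times> 'a::euclidean_space \<Rightarrow> real) \<Rightarrow> real \<times> 'a \<Rightarrow> real" where
  "laplacian T \<psi> z =
     (\<Sum>e\<in>Basis. dir_deriv (spacetime T) (0, e) (dir_deriv (spacetime T) (0, e) \<psi>) z)"

definition deriv_coeff :: "(real \<Rightarrow> real) \<Rightarrow> real \<Rightarrow> real" where
  "deriv_coeff b t = vector_derivative b (at t within {0..})"

text \<open>
  Weak solutions on \<open>[0,T)\<close> of \<open>u\<^sub>t\<^sub>t - \<Delta>u + b(t) u\<^sub>t = N(u)\<close> with \<open>u(0) = u0\<close>, \<open>u\<^sub>t(0) = u1\<close>.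
  For \<open>N\<close> of growth \<open>p \<ge> 1\<close> and locally integrable data all four integrands are integrable, so the
  convention that the integral of a non-integrable function is \<open>0\<close> plays no role.
\<close>

definition weak_solution ::
    "real \<Rightarrow> (real \<Rightarrow> real) \<Rightarrow> (real \<Rightarrow> real) \<Rightarrow> ('a::euclidean_space \<Rightarrow> real) \<Rightarrow> ('a \<Rightarrow> real) \<Rightarrow>
     real \<Rightarrow> (real \<times> 'a \<Rightarrow> real) \<Rightarrow> bool" where
  "weak_solution p b N u0 u1 T u \<longleftrightarrow>
     u \<in> Lp_loc p (spacetime T) \<and>
     (\<forall>\<psi>\<in>test_functions (spacetime T).
        (LINT z:spacetime T|lebesgue.
           u z * (time_deriv T (time_deriv T \<psi>) z - laplacian T \<psi> z
                  - deriv_coeff b (fst z) * \<psi> z - b (fst z) * time_deriv T \<psi> z))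
        = - (LINT x|lebesgue. u0 x * time_deriv T \<psi> (0, x))
          + (LINT x|lebesgue. (b 0 * u0 x + u1 x) * \<psi> (0, x))
          + (LINT z:spacetime T|lebesgue. N (u z) * \<psi> z))"

end

theory Submission
  imports Defs
begin

text \<open>
  Test the equation with \<open>\<psi>(z) = exp (- 1 / (1 - \<bar>z\<bar>\<^sup>2 / \<rho>\<^sup>2))\<close>, for \<open>z = (t, x)\<close> with \<open>\<bar>z\<bar> < \<rho>\<close>,
  extended by \<open>0\<close>, where \<open>\<rho> < min 1 T\<close>.
  It is even in \<open>t\<close>, so that \<open>\<partial>\<^sub>t \<psi>(0, x) = 0\<close> and \<open>u0\<close> enters only through \<open>b(0) u0 + u1\<close>. The adjoint
  operator applied to \<open>\<psi>\<close> is in absolute value at most \<open>C \<rho>\<^sup>-\<^sup>2 \<psi>\<^bsup>1/p\<^esup>\<close>, because \<open>exp (- c / y) / y\<^bsup>n\<^esup>\<close> is bounded for every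
  \<open>c > 0\<close>. Hence Young's inequality absorbs \<open>u\<close> into \<open>\<integral> \<bar>u\<bar>\<^bsup>p\<^esup> \<psi>\<close>, and with \<open>q = p / (p - 1)\<close>
  the data satisfy
  \<open>c \<rho>\<^bsup>d-k\<^esup> \<le> \<integral> \<sigma> (b(0) u0 + u1) \<psi>(0, x) dx \<le> C \<rho>\<^bsup>d+1-2q\<^esup>\<close>. Since \<open>k > (p + 1) / (p - 1) = 2 q - 1\<close>, this
  fails as \<open>\<rho> \<rightarrow> 0\<close>.
\<close>

section \<open>Functions flat at the origin\<close>

text \<open>The parameter \<open>n\<close> makes the family closed under differentiation up to
  linear combinations, so all derivatives are handled at once; \<open>flat 0\<close> is the
  classical smooth function that is not analytic at 0.\<close>

definition flat :: "nat \<Rightarrow> real \<Rightarrow> real" where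
  "flat n y = (if y > 0 then exp (- 1 / y) / y ^ n else 0)"

lemma flat_nonneg: "flat n y \<ge> 0"
  by (simp add: flat_def)

lemma flat_0_le_1: "flat 0 y \<le> 1"
  by (simp add: flat_def)

text \<open>Raise \<open>1 + x / n \<le> exp (x / n)\<close> to the power \<open>n\<close>; for
  \<open>n = 0\<close> the convention \<open>0 ^ 0 = 1\<close> fits.\<close>

lemma power_le_power_times_exp:
  assumes "x \<ge> (0::real)"
  shows "x ^ n \<le> real n ^ n * exp x"
proof (cases "n = 0")
  case False
  have "0 \<le> x / n" using assms by simp
  hence "(x / n) ^ n \<le> exp (x / n) ^ n"
    using assms exp_ge_add_one_self[of "x / n"] by (intro power_mono) linarith+
  also have "\<dots> = exp x"
    using False by (simp add: exp_of_nat_mult[symmetric])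
  finally show ?thesis
    using False by (simp add: field_simps power_divide)
qed (use assms in auto)

lemma exp_div_power_bound:
  assumes "c > (0::real)" "y > 0"
  shows "exp (- c / y) / y ^ n \<le> (n / c) ^ n"
proof -
  have "(c / y) ^ n \<le> real n ^ n * exp (c / y)"
    using assms by (intro power_le_power_times_exp) auto
  hence "c ^ n * exp (- (c / y)) / y ^ n \<le> real n ^ n"
    using assms by (simp add: exp_minus field_simps power_divide)
  thus ?thesis
    using assms by (simp add: field_simps power_divide)
qed

lemma flat_bound: "flat n y \<le> real n ^ n"
  using exp_div_power_bound[of 1 y n] by (simp add: flat_def)

text \<open>Split \<open>exp (- 1 / y)\<close> into its powers with exponents \<open>s\<close> and
  \<open>1 - s\<close>: the first is kept, the second absorbs \<open>1 / y ^ n\<close>. Young's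
  inequality will need \<open>s = 1 / p\<close>.\<close>

lemma flat_le_powr:
  assumes "0 \<le> s" "s < 1"
  shows "flat n y \<le> (n / (1 - s)) ^ n * flat 0 y powr s"
proof (cases "y > 0")
  case True
  have "flat n y = flat 0 y powr s * (exp (- (1 - s) / y) / y ^ n)"
    using True by (simp add: flat_def powr_def exp_add[symmetric] field_simps)
  also have "\<dots> \<le> flat 0 y powr s * (n / (1 - s)) ^ n"
    using assms True exp_div_power_bound[of "1 - s" y n] by (intro mult_left_mono) auto
  finally show ?thesis by (simp add: mult_ac)
qed (auto simp: flat_def)

text \<open>Only \<open>y = 0\<close> is delicate: there
  \<open>flat n h / h = flat (n + 2) h * h\<close> for \<open>h > 0\<close>, and boundedness of
  \<open>flat (n + 2)\<close> sends the difference quotient to 0.\<close>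

lemma DERIV_flat:
  "(flat n has_real_derivative (flat (n + 2) y - n * flat (n + 1) y)) (at y)"
proof -
  consider "y > 0" | "y < 0" | "y = 0" by linarith
  thus ?thesis
  proof cases
    case 1
    have "((\<lambda>y. exp (- 1 / y) / y ^ n) has_real_derivative
        (flat (n + 2) y - n * flat (n + 1) y)) (at y)"
    proof (rule DERIV_cong)
      show "((\<lambda>y. exp (- 1 / y) / y ^ n) has_real_derivative
          (exp (- 1 / y) * (1 / y\<^sup>2) * y ^ n - exp (- 1 / y) * (n * y ^ (n - 1))) / (y ^ n * y ^ n)) (at y)"
        using 1 by (intro DERIV_divide DERIV_fun_exp DERIV_pow)
          (auto intro!: derivative_eq_intros simp: power2_eq_square)
      \<comment> \<open>For \<open>n = 0\<close> the truncated \<open>n - 1\<close> does no harm,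
        because the factor \<open>n\<close> vanishes.\<close>
      have "n * y ^ (n - 1) * y = n * y ^ n" by (cases n) auto
      hence "n * y ^ (n - 1) = n * y ^ n / y" using 1 by (simp add: eq_divide_eq)
      thus "(exp (- 1 / y) * (1 / y\<^sup>2) * y ^ n - exp (- 1 / y) * (n * y ^ (n - 1))) / (y ^ n * y ^ n) =
          flat (n + 2) y - n * flat (n + 1) y"
        using 1 by (simp add: flat_def diff_divide_distrib power_add power2_eq_square)
    qed
    thus ?thesis
      by (rule has_field_derivative_transform_within_open[where S = "{0<..}"])
        (use 1 in \<open>auto simp: flat_def\<close>)
  next
    case 2
    have "((\<lambda>y. 0) has_real_derivative (flat (n + 2) y - n * flat (n + 1) y)) (at y)"
      using 2 by (auto simp: flat_def)
    thus ?thesis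
      by (rule has_field_derivative_transform_within_open[where S = "{..<0}"])
        (use 2 in \<open>auto simp: flat_def\<close>)
  next
    case 3
    define C where "C = real (n + 2) ^ (n + 2)"
    have C: "C \<ge> 0" by (simp add: C_def)
    have bound: "norm ((flat n h - flat n 0) / (h - 0)) \<le> C * \<bar>h\<bar>" for h :: real
    proof (cases "h > 0")
      case True
      hence "norm ((flat n h - flat n 0) / (h - 0)) = flat (n + 2) h * h"
        by (simp add: flat_def)
      also have "\<dots> \<le> C * \<bar>h\<bar>"
        using True flat_bound[of "n + 2" h] unfolding C_def[symmetric] by (simp add: mult_right_mono)
      finally show ?thesis .
    qed (use C in \<open>simp add: flat_def mult_nonneg_nonpos\<close>)
    have "((\<lambda>h. C * \<bar>h\<bar>) \<longlongrightarrow> 0) (at 0)"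
      by (rule tendsto_eq_intros refl | simp)+
    hence "((\<lambda>h. (flat n h - flat n 0) / (h - 0)) \<longlongrightarrow> 0) (at 0)"
      by (rule Lim_null_comparison[OF always_eventually, rotated]) (use bound in blast)
    thus ?thesis
      using 3 by (simp add: has_field_derivative_iff flat_def)
  qed
qed

section \<open>Closure properties of \<open>Ck_on\<close>\<close>

lemma Ck_on_Suc_imp: "Ck_on (Suc k) S f \<Longrightarrow> Ck_on k S f"
proof (induction k arbitrary: f)
  case 0
  thus ?case by (auto intro: has_derivative_continuous_on)
next
  case (Suc k)
  then obtain f' where "\<forall>x\<in>S. (f has_derivative f' x) (at x within S)"
      and "\<forall>v. Ck_on (Suc k) S (\<lambda>x. f' x v)"
    by auto
  thus ?case using Suc.IH by auto
qed

lemma Ck_on_const: "Ck_on k S (\<lambda>x. c)"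
proof (induction k arbitrary: c)
  case (Suc k)
  show ?case
    unfolding Ck_on.simps by (intro exI[where x = "\<lambda>x v. 0"]) (simp add: Suc)
qed simp

lemma Ck_on_add: "Ck_on k S f \<Longrightarrow> Ck_on k S g \<Longrightarrow> Ck_on k S (\<lambda>x. f x + g x)"
proof (induction k arbitrary: f g)
  case (Suc k)
  obtain f' where f': "\<forall>x\<in>S. (f has_derivative f' x) (at x within S)"
      "\<forall>v. Ck_on k S (\<lambda>x. f' x v)"
    using Suc.prems by auto
  obtain g' where g': "\<forall>x\<in>S. (g has_derivative g' x) (at x within S)"
      "\<forall>v. Ck_on k S (\<lambda>x. g' x v)"
    using Suc.prems by auto
  show ?case
    unfolding Ck_on.simps
    by (rule exI[where x = "\<lambda>x v. f' x v + g' x v"])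
      (use f' g' Suc.IH in \<open>auto intro: has_derivative_add\<close>)
qed (auto intro: continuous_on_add)

lemma Ck_on_mult: "Ck_on k S f \<Longrightarrow> Ck_on k S g \<Longrightarrow> Ck_on k S (\<lambda>x. f x * g x)"
proof (induction k arbitrary: f g)
  case (Suc k)
  obtain f' where f': "\<forall>x\<in>S. (f has_derivative f' x) (at x within S)"
      "\<forall>v. Ck_on k S (\<lambda>x. f' x v)"
    using Suc.prems by auto
  obtain g' where g': "\<forall>x\<in>S. (g has_derivative g' x) (at x within S)"
      "\<forall>v. Ck_on k S (\<lambda>x. g' x v)"
    using Suc.prems by auto
  \<comment> \<open>The product rule leaves factors undifferentiated, so their regularity is lowered
    from \<open>Suc k\<close> to \<open>k\<close>.\<close>
  have "Ck_on k S f" "Ck_on k S g" using Suc.prems Ck_on_Suc_imp by blast+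
  thus ?case
    unfolding Ck_on.simps
    by (intro exI[where x = "\<lambda>x v. f x * g' x v + f' x v * g x"] conjI ballI allI
        has_derivative_mult Ck_on_add Suc.IH)
      (use f' g' in auto)
qed (auto intro: continuous_on_mult)

lemma Ck_on_inner: "Ck_on k S (\<lambda>x. x \<bullet> v)"
proof (cases k)
  case (Suc m)
  have "\<forall>x\<in>S. ((\<lambda>x. x \<bullet> v) has_derivative (\<lambda>w. w \<bullet> v)) (at x within S)"
    by (auto intro!: derivative_eq_intros)
  thus ?thesis unfolding Suc Ck_on.simps
    by (intro exI[where x = "\<lambda>x w. w \<bullet> v"]) (simp add: Ck_on_const)
qed (auto intro: continuous_intros)

section \<open>The test function and its support\<close>

text \<open>For \<open>c = 1 / \<rho>\<^sup>2\<close> and \<open>n = 0\<close> this is the test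
  function; larger \<open>n\<close> occur in its derivatives. The general type allows its use on
  spacetime and, as the trace at \<open>t = 0\<close>, on space.\<close>

definition bump :: "real \<Rightarrow> nat \<Rightarrow> 'a::real_inner \<Rightarrow> real" where
  "bump c n z = flat n (1 - c * (z \<bullet> z))"

definition bump_deriv :: "real \<Rightarrow> nat \<Rightarrow> 'a::real_inner \<Rightarrow> 'a \<Rightarrow> real" where
  "bump_deriv c n z v = (bump c (n + 2) z + - real n * bump c (n + 1) z) * (-2 * c * (z \<bullet> v))"

lemma has_derivative_bump: "(bump c n has_derivative bump_deriv c n z) (at z within S)"
proof -
  have "((\<lambda>z. 1 - c * (z \<bullet> z)) has_derivative (\<lambda>v. - 2 * c * (z \<bullet> v))) (at z within S)"
    by (auto intro!: derivative_eq_intros simp: algebra_simps inner_commute)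
  from has_derivative_compose[OF this DERIV_flat[of n, unfolded has_field_derivative_def]]
  show ?thesis
    by (simp add: bump_def[abs_def] bump_deriv_def[abs_def] algebra_simps)
qed

text \<open>A derivative consists of bumps of higher index times a linear function, so the induction
  on \<open>k\<close> must cover all \<open>n\<close>.\<close>

lemma Ck_on_bump: "Ck_on k S (bump c n)"
proof (induction k arbitrary: n)
  case 0
  show ?case
    using has_derivative_continuous_on[OF has_derivative_bump] by simp
next
  case (Suc k)
  have "\<forall>x\<in>S. (bump c n has_derivative bump_deriv c n x) (at x within S)"
    using has_derivative_bump by blast
  moreover have "Ck_on k S (\<lambda>x. bump_deriv c n x v)" for v
    unfolding bump_deriv_def by (intro Ck_on_mult Ck_on_add Ck_on_const Ck_on_inner Suc)
  ultimately show ?case by auto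
qed

lemma bump_nonneg: "bump c n z \<ge> 0"
  by (simp add: bump_def flat_nonneg)

lemma bump_0_le_1: "bump c 0 z \<le> 1"
  by (simp add: bump_def flat_0_le_1)

lemma bump_eq_0:
  assumes "\<rho> > 0" "norm z \<ge> \<rho>"
  shows "bump (1 / \<rho>\<^sup>2) n z = 0"
proof -
  have "\<rho>\<^sup>2 \<le> (norm z)\<^sup>2" using assms by (intro power_mono) auto
  hence "\<not> 1 - (norm z)\<^sup>2 / \<rho>\<^sup>2 > 0" using assms by (simp add: divide_simps not_less)
  thus ?thesis by (simp add: bump_def flat_def dot_square_norm)
qed

text \<open>On the half-radius ball the argument of \<open>flat 0\<close> is at least
  \<open>3 / 4\<close>, which gives a bound independent of \<open>\<rho>\<close>.\<close>

lemma bump_0_lower_bound: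
  assumes "\<rho> > 0" "norm z < \<rho> / 2"
  shows "exp (- 4 / 3) \<le> bump (1 / \<rho>\<^sup>2) 0 z"
proof -
  have "(norm z)\<^sup>2 \<le> (\<rho> / 2)\<^sup>2" using assms by (intro power_mono) auto
  hence "(norm z)\<^sup>2 / \<rho>\<^sup>2 \<le> 1 / 4" using assms by (simp add: field_simps power2_eq_square)
  hence y: "3 / 4 \<le> 1 - (norm z)\<^sup>2 / \<rho>\<^sup>2" by linarith
  have "1 / (1 - (norm z)\<^sup>2 / \<rho>\<^sup>2) \<le> 1 / (3 / 4)"
    using y by (intro divide_left_mono) auto
  moreover have "1 - (norm z)\<^sup>2 / \<rho>\<^sup>2 > 0" using y by linarith
  ultimately show ?thesis by (simp only: bump_def flat_def dot_square_norm) simp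
qed

text \<open>This compact half ball serves twice: it contains the support of the test function, and
  on it the local integrability of \<open>u\<close> is applied.\<close>

lemma half_cball_subset_spacetime:
  assumes "\<rho> < T"
  shows "({0..} \<times> UNIV) \<inter> cball 0 \<rho> \<subseteq> (spacetime T :: (real \<times> 'a::euclidean_space) set)"
proof
  fix z :: "real \<times> 'a"
  assume "z \<in> ({0..} \<times> UNIV) \<inter> cball 0 \<rho>"
  thus "z \<in> spacetime T"
    using assms norm_fst_le[of "fst z" "snd z"] by (cases z) auto
qed

lemma bump_test_function:
  assumes "0 < \<rho>" "\<rho> < T"
  shows "bump (1 / \<rho>\<^sup>2) n \<in> test_functions (spacetime T :: (real \<times> 'a::euclidean_space) set)"
proof -
  let ?K = "({0..} \<times> UNIV) \<inter> cball 0 \<rho> :: (real \<times> 'a) set"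
  let ?C = "closure (support_on (spacetime T) (bump (1 / \<rho>\<^sup>2) n)) :: (real \<times> 'a) set"
  have K: "compact ?K" by (intro closed_Int_compact closed_Times) auto
  have "support_on (spacetime T) (bump (1 / \<rho>\<^sup>2) n) \<subseteq> ?K"
    using bump_eq_0[OF assms(1)] by (force simp: support_on_def)
  hence C: "?C \<subseteq> ?K" using K by (intro closure_minimal compact_imp_closed)
  have "compact ?C" using closed_Int_compact[OF closed_closure K] C by (metis inf.absorb1)
  moreover have "?K \<subseteq> spacetime T"
    using assms(2) by (rule half_cball_subset_spacetime)
  ultimately show ?thesis
    using C by (auto simp: test_functions_def smooth_on_def Ck_on_bump)
qed

section \<open>Derivatives of the test function and their size\<close>

text \<open>Spacetime is not open, so uniqueness of the derivative within it has to be checked: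
  every point, also at \<open>t = 0\<close>, admits arbitrarily small forward steps along each basis
  vector.\<close>

lemma dir_deriv_spacetime:
  assumes "z \<in> spacetime T" and "(f has_derivative f') (at z within spacetime T)"
  shows "dir_deriv (spacetime T) v f z = f' v"
proof -
  have "(f has_derivative frechet_derivative f (at z within spacetime T)) (at z within spacetime T)"
    using assms(2) differentiable_def frechet_derivative_works by blast
  hence "frechet_derivative f (at z within spacetime T) = f'"
  proof (rule frechet_derivative_unique_within[OF _ assms(2)])
    fix i :: "real \<times> 'a" and e :: real
    assume i: "i \<in> Basis" and "e > 0"
    obtain t x where z: "z = (t, x)" "0 \<le> t" "t < T" using assms(1) by auto
    define d where "d = min (e / 2) ((T - t) / 2)"
    have d: "0 < d" "d < e" "t + d < T"
      using z \<open>e > 0\<close> by (auto simp: d_def min_def field_simps)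
    have "fst i = 1 \<or> fst i = 0" using i by (auto simp: Basis_prod_def)
    hence "z + d *\<^sub>R i \<in> spacetime T" using z d by (cases i) auto
    thus "\<exists>d. 0 < \<bar>d\<bar> \<and> \<bar>d\<bar> < e \<and> z + d *\<^sub>R i \<in> spacetime T" using d by (intro exI[of _ d]) auto
  qed
  thus ?thesis by (simp add: dir_deriv_def)
qed

lemma dir_deriv_bump:
  "z \<in> spacetime T \<Longrightarrow> dir_deriv (spacetime T) v (bump c 0) z = -2 * c * (z \<bullet> v) * bump c 2 z"
  by (subst dir_deriv_spacetime[OF _ has_derivative_bump])
    (simp_all add: bump_deriv_def eval_nat_numeral)

lemma dir_deriv2_bump:
  assumes "z \<in> spacetime T"
  shows "dir_deriv (spacetime T) v (dir_deriv (spacetime T) v (bump c 0)) z =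
    4 * (c * (z \<bullet> v))\<^sup>2 * (bump c 4 z - 2 * bump c 3 z) - 2 * c * (v \<bullet> v) * bump c 2 z"
proof -
  have "((\<lambda>z. -2 * c * (z \<bullet> v) * bump c 2 z) has_derivative
      (\<lambda>w. -2 * c * (z \<bullet> v) * bump_deriv c 2 z w + -2 * c * (w \<bullet> v) * bump c 2 z))
      (at z within spacetime T)"
    by (rule has_derivative_mult[OF _ has_derivative_bump]) (auto intro!: derivative_eq_intros)
  \<comment> \<open>The formula for the first derivative is known on \<open>spacetime T\<close>
    only, which is enough for a derivative within that set.\<close>
  hence "(dir_deriv (spacetime T) v (bump c 0) has_derivative
      (\<lambda>w. -2 * c * (z \<bullet> v) * bump_deriv c 2 z w + -2 * c * (w \<bullet> v) * bump c 2 z))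
      (at z within spacetime T)"
    by (rule has_derivative_transform[OF assms dir_deriv_bump, rotated])
  from dir_deriv_spacetime[OF assms this, of v]
  have "dir_deriv (spacetime T) v (dir_deriv (spacetime T) v (bump c 0)) z =
      -2 * c * (z \<bullet> v) * bump_deriv c 2 z v + -2 * c * (v \<bullet> v) * bump c 2 z" .
  also have "bump_deriv c 2 z v = (bump c 4 z - 2 * bump c 3 z) * (-2 * c * (z \<bullet> v))"
    by (simp add: bump_deriv_def)
  finally show ?thesis
    by (simp only: power2_eq_square) (simp add: algebra_simps)
qed

text \<open>Two derivatives raise the index from 0 to at most 4, so one constant covers every bump
  that occurs.\<close>

lemma bump_le_powr:
  assumes "0 \<le> s" "s < 1" "n \<le> 4"
  shows "bump c n z \<le> (4 / (1 - s)) ^ 4 * bump c 0 z powr s"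
proof -
  have "(n / (1 - s)) ^ n \<le> (4 / (1 - s)) ^ n"
    using assms by (intro power_mono divide_right_mono) auto
  also have "\<dots> \<le> (4 / (1 - s)) ^ 4"
    using assms by (intro power_increasing) auto
  finally have "(n / (1 - s)) ^ n * bump c 0 z powr s \<le> (4 / (1 - s)) ^ 4 * bump c 0 z powr s"
    by (intro mult_right_mono) auto
  thus ?thesis
    using flat_le_powr[OF assms(1,2), of n "1 - c * (z \<bullet> z)"] unfolding bump_def by linarith
qed

text \<open>Inside the ball, \<open>\<bar>z \<bullet> v\<bar> \<le> \<rho> \<le> 1\<close> bounds
  both \<open>\<bar>c * (z \<bullet> v)\<bar>\<close> and its square by \<open>c\<close>; outside,
  all bumps vanish. The constant 14 is \<open>4 * 3 + 2\<close>, read off from the formula for the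
  second derivative.\<close>

lemma
  fixes z v :: "real \<times> 'a::euclidean_space"
  assumes "0 < \<rho>" "\<rho> \<le> 1" "0 \<le> s" "s < 1" "v \<in> Basis" "z \<in> spacetime T"
  defines "c \<equiv> 1 / \<rho>\<^sup>2"
  defines "W \<equiv> c * ((4 / (1 - s)) ^ 4 * bump c 0 z powr s)"
  shows dir_deriv_bump_bound: "\<bar>dir_deriv (spacetime T) v (bump c 0) z\<bar> \<le> 2 * W"
    and dir_deriv2_bump_bound:
      "\<bar>dir_deriv (spacetime T) v (dir_deriv (spacetime T) v (bump c 0)) z\<bar> \<le> 14 * W"
proof -
  let ?b = "\<lambda>n. bump c n z"
  let ?V = "(4 / (1 - s)) ^ 4 * bump c 0 z powr s"
  have V: "\<bar>?b n\<bar> \<le> ?V" if "n \<le> 4" for n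
    using bump_le_powr[OF assms(3,4) that, of c z] bump_nonneg[of c n z] by simp
  have "\<bar>dir_deriv (spacetime T) v (bump c 0) z\<bar> \<le> 2 * W \<and>
    \<bar>dir_deriv (spacetime T) v (dir_deriv (spacetime T) v (bump c 0)) z\<bar> \<le> 14 * W"
  proof (cases "norm z < \<rho>")
    case False
    hence "?b n = 0" for n using bump_eq_0[OF assms(1), of z] by (simp add: c_def)
    thus ?thesis using assms by (simp add: dir_deriv_bump dir_deriv2_bump W_def)
  next
    case True
    have zv: "\<bar>z \<bullet> v\<bar> \<le> \<rho>"
      using Basis_le_norm[OF assms(5), of z] True by simp
    have c: "c > 0" using assms(1) by (simp add: c_def)
    have A: "\<bar>c * (z \<bullet> v)\<bar> \<le> c"
      using zv assms(2) c by (simp add: abs_mult mult_left_le)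
    have "(z \<bullet> v)\<^sup>2 \<le> \<rho>\<^sup>2" using zv assms(1) by (simp add: abs_le_square_iff[symmetric])
    hence "c * (c * (z \<bullet> v)\<^sup>2) \<le> c * 1"
      using c assms(1) by (intro mult_left_mono) (auto simp: c_def field_simps)
    hence B: "(c * (z \<bullet> v))\<^sup>2 \<le> c" by (simp add: power2_eq_square mult_ac)
    have "\<bar>c * (z \<bullet> v)\<bar> * \<bar>?b 2\<bar> \<le> c * ?V"
      using A V[of 2] c by (intro mult_mono) auto
    hence "\<bar>dir_deriv (spacetime T) v (bump c 0) z\<bar> \<le> 2 * W"
      using assms(6) by (simp add: dir_deriv_bump abs_mult W_def)
    moreover have "(c * (z \<bullet> v))\<^sup>2 * \<bar>?b 4 - 2 * ?b 3\<bar> \<le> c * (3 * ?V)"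
      using B V[of 4] V[of 3] c by (intro mult_mono) auto
    hence "\<bar>(c * (z \<bullet> v))\<^sup>2 * (?b 4 - 2 * ?b 3)\<bar> \<le> 3 * W"
      by (simp add: abs_mult W_def)
    moreover have "\<bar>c * ?b 2\<bar> \<le> W"
      using V[of 2] c by (simp add: abs_mult W_def)
    ultimately show ?thesis
      using assms(5,6) by (simp add: dir_deriv2_bump)
  qed
  thus "\<bar>dir_deriv (spacetime T) v (bump c 0) z\<bar> \<le> 2 * W"
    and "\<bar>dir_deriv (spacetime T) v (dir_deriv (spacetime T) v (bump c 0)) z\<bar> \<le> 14 * W"
    by blast+
qed

section \<open>Estimates for the adjoint operator\<close>

text \<open>The unit interval suffices, since the test functions live in balls of radius at most
  1.\<close>

lemma C1_coefficient_bounds: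
  assumes "Ck_on 1 {0..} b"
  obtains B where "B \<ge> 0" "\<And>t. t \<in> {0..1} \<Longrightarrow> \<bar>b t\<bar> \<le> B" "\<And>t. t \<in> {0..1} \<Longrightarrow> \<bar>deriv_coeff b t\<bar> \<le> B"
proof -
  obtain b' where b': "\<And>t. t \<ge> 0 \<Longrightarrow> (b has_derivative b' t) (at t within {0..})"
      and cont: "continuous_on {0..} (\<lambda>t. b' t 1)"
    using assms by auto
  have deriv: "deriv_coeff b t = b' t 1" if "t \<ge> 0" for t
  proof -
    \<comment> \<open>A linear map on the reals is multiplication by its value at 1; this turns the
      Frechet derivative into a vector derivative.\<close>
    have "b' t = (\<lambda>x. x *\<^sub>R b' t 1)"
    proof
      fix x
      show "b' t x = x *\<^sub>R b' t 1"
        using linear_cmul[OF has_derivative_linear[OF b'[OF that]], of x 1] by simp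
    qed
    hence "(b has_vector_derivative b' t 1) (at t within {0..})"
      using b'[OF that] unfolding has_vector_derivative_def by metis
    \<comment> \<open>Points to the right of \<open>t\<close> make the filter nontrivial even at
      \<open>t = 0\<close>, so the one-sided derivative is unique.\<close>
    moreover have "{t<..} \<subseteq> {0..}" using that by auto
    from at_le[OF this, of t] have "at t within {0..} \<noteq> bot" by (auto simp: bot_unique)
    ultimately show ?thesis
      unfolding deriv_coeff_def by (intro vector_derivative_within)
  qed
  have "continuous_on {0..} b" using b' has_derivative_continuous_on[of "{0..}" b b'] by auto
  hence "bounded (b ` {0..1})" "bounded ((\<lambda>t. b' t 1) ` {0..1})"
    using cont by (intro compact_imp_bounded compact_continuous_image; force elim: continuous_on_subset)+
  then obtain B1 B2 where "\<forall>t\<in>{0..1}. \<bar>b t\<bar> \<le> B1" "\<forall>t\<in>{0..1}. \<bar>b' t 1\<bar> \<le> B2"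
    by (auto simp: bounded_iff)
  thus ?thesis
    by (intro that[of "max 0 (max B1 B2)"]) (force simp: deriv)+
qed

text \<open>Young's inequality for \<open>\<bar>u\<bar> * X powr (1 / p)\<close> and
  \<open>A\<close>: the weight becomes exactly \<open>X\<close> after taking the power
  \<open>p\<close>, and the factors \<open>1 / p\<close> and \<open>(p - 1) / p\<close> are
  dropped.\<close>

lemma Young_absorb:
  fixes p :: real
  assumes "p > 1" "A \<ge> 0" "X \<ge> 0" "\<bar>f\<bar> \<le> A * X powr (1 / p)"
  shows "u * f \<le> \<bar>u\<bar> powr p * X + A powr (p / (p - 1))"
proof -
  have "u * f \<le> \<bar>u\<bar> * \<bar>f\<bar>" by (metis abs_ge_self abs_mult)
  also have "\<dots> \<le> (\<bar>u\<bar> * X powr (1 / p)) * A"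
    using mult_left_mono[OF assms(4), of "\<bar>u\<bar>"] by (simp add: mult_ac)
  also have "\<dots> \<le> (\<bar>u\<bar> * X powr (1 / p)) powr p / p + A powr (p / (p - 1)) / (p / (p - 1))"
    using assms by (intro Youngs_inequality) (auto simp: field_simps)
  also have "(\<bar>u\<bar> * X powr (1 / p)) powr p = \<bar>u\<bar> powr p * X"
    using assms by (simp add: powr_mult powr_powr)
  also have "\<bar>u\<bar> powr p * X / p \<le> \<bar>u\<bar> powr p * X"
    using assms mult_left_le[of "1 / p" "\<bar>u\<bar> powr p * X"] by simp
  also have "A powr (p / (p - 1)) / (p / (p - 1)) \<le> A powr (p / (p - 1))"
    using assms mult_left_le[of "(p - 1) / p" "A powr (p / (p - 1))"] by simp
  finally show ?thesis by simp
qed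

text \<open>The last two terms expand the time derivative of \<open>b \<psi>\<close> with a minus
  sign, as integration by parts of the damping term produces it.\<close>

abbreviation adjoint_op ::
    "real \<Rightarrow> (real \<Rightarrow> real) \<Rightarrow> (real \<times> 'a::euclidean_space \<Rightarrow> real) \<Rightarrow> real \<times> 'a \<Rightarrow> real" where
  "adjoint_op T b \<psi> z \<equiv> time_deriv T (time_deriv T \<psi>) z - laplacian T \<psi> z
     - deriv_coeff b (fst z) * \<psi> z - b (fst z) * time_deriv T \<psi> z"

text \<open>Each of the \<open>1 + DIM('a)\<close> second derivatives contributes 14, the damping
  terms \<open>B\<close> and \<open>2 * B\<close>. As \<open>\<rho> \<le> 1\<close>, the lower-order
  terms fit into the same scale \<open>1 / \<rho>\<^sup>2\<close>.\<close>

lemma adjoint_op_bump_bound: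
  fixes z :: "real \<times> 'a::euclidean_space" and B :: real
  assumes "0 < \<rho>" "\<rho> \<le> 1" "0 \<le> s" "s < 1" "z \<in> spacetime T" "B \<ge> 0"
    and b: "\<And>t. t \<in> {0..1} \<Longrightarrow> \<bar>b t\<bar> \<le> B" "\<And>t. t \<in> {0..1} \<Longrightarrow> \<bar>deriv_coeff b t\<bar> \<le> B"
  shows "\<bar>adjoint_op T b (bump (1 / \<rho>\<^sup>2) 0) z\<bar> \<le>
    (14 + 14 * DIM('a) + 3 * B) * (4 / (1 - s)) ^ 4 / \<rho>\<^sup>2 * bump (1 / \<rho>\<^sup>2) 0 z powr s"
proof -
  define c where "c = 1 / \<rho>\<^sup>2"
  let ?\<psi> = "bump c 0 :: real \<times> 'a \<Rightarrow> real"
  define W where "W = c * ((4 / (1 - s)) ^ 4 * ?\<psi> z powr s)"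
  have c: "c \<ge> 1" using assms(1,2) by (simp add: c_def power_le_one)
  have W: "W \<ge> 0" unfolding W_def using c by (intro mult_nonneg_nonneg) auto
  have bound1: "\<bar>dir_deriv (spacetime T) v ?\<psi> z\<bar> \<le> 2 * W"
    and bound2: "\<bar>dir_deriv (spacetime T) v (dir_deriv (spacetime T) v ?\<psi>) z\<bar> \<le> 14 * W"
    if "v \<in> Basis" for v
    using dir_deriv_bump_bound[OF assms(1-4) that assms(5)]
      dir_deriv2_bump_bound[OF assms(1-4) that assms(5)]
    by (auto simp: c_def W_def)
  have time: "(1, 0) \<in> (Basis :: (real \<times> 'a) set)" by (auto simp: Basis_prod_def)
  have space: "(0, e) \<in> (Basis :: (real \<times> 'a) set)" if "e \<in> Basis" for e
    using that by (auto simp: Basis_prod_def)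
  have "\<bar>laplacian T ?\<psi> z\<bar> \<le> (\<Sum>e\<in>(Basis :: 'a set). 14 * W)"
    unfolding laplacian_def by (intro order.trans[OF sum_abs] sum_mono bound2 space)
  hence lap: "\<bar>laplacian T ?\<psi> z\<bar> \<le> 14 * DIM('a) * W" by simp
  have coeff: "\<bar>deriv_coeff b (fst z) * ?\<psi> z\<bar> \<le> B * W \<and> \<bar>b (fst z) * time_deriv T ?\<psi> z\<bar> \<le> B * (2 * W)"
  \<comment> \<open>The coefficients are controlled for times in \<open>{0..1}\<close> only; outside
    the ball the test function and its derivative vanish instead.\<close>
  proof (cases "norm z < \<rho>")
    case True
    hence "fst z \<in> {0..1}" using assms(2,5) norm_fst_le[of "fst z" "snd z"] by auto
    note b = b[OF this]
    have "?\<psi> z \<le> (4 / (1 - s)) ^ 4 * ?\<psi> z powr s"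
      using bump_le_powr[OF assms(3,4), of 0] by simp
    also have "\<dots> = 1 * \<dots>" by simp
    also have "\<dots> \<le> W"
      unfolding W_def using c by (intro mult_right_mono mult_nonneg_nonneg) auto
    finally have "\<bar>?\<psi> z\<bar> \<le> W" using bump_nonneg[of c 0 z] by simp
    thus ?thesis
      unfolding abs_mult time_deriv_def using b assms(6) bound1[OF time]
      by (intro conjI mult_mono) auto
  next
    case False
    hence "bump c n z = 0" for n using bump_eq_0[OF assms(1), of z n] by (simp add: c_def)
    thus ?thesis using W assms(5,6) by (simp add: time_deriv_def dir_deriv_bump)
  qed
  have "\<bar>adjoint_op T b ?\<psi> z\<bar> \<le> 14 * W + 14 * DIM('a) * W + B * W + B * (2 * W)"
    using bound2[OF time] lap coeff unfolding time_deriv_def by linarith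
  also have "\<dots> = (14 + 14 * DIM('a) + 3 * B) * W" by (simp add: algebra_simps)
  finally show ?thesis by (simp add: W_def c_def)
qed

section \<open>Integrability against the test function\<close>

lemma borel_measurable_bump [measurable]: "bump c n \<in> borel_measurable borel"
  using has_derivative_continuous_on[OF has_derivative_bump]
  by (intro borel_measurable_continuous_onI)

text \<open>The bump is at most 1 and vanishes off the ball, and
  \<open>\<bar>f x\<bar> \<le> (f x)\<^sup>2 + 1\<close> there gives an integrable majorant.\<close>

lemma integrable_L2_times_bump:
  assumes "f \<in> L2_space" "0 < \<rho>"
  shows "integrable lebesgue (\<lambda>x::'a::euclidean_space. f x * bump (1 / \<rho>\<^sup>2) 0 x)"
proof (rule Bochner_Integration.integrable_bound)
  show "integrable lebesgue (\<lambda>x::'a. (f x)\<^sup>2 + indicator (ball 0 \<rho>) x)"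
    using assms(1) unfolding L2_space_def
    by (intro Bochner_Integration.integrable_add integrable_real_indicator)
      (auto simp: emeasure_ball assms less_imp_le)
  have "bump (1 / \<rho>\<^sup>2) 0 \<in> borel_measurable (lebesgue :: 'a measure)"
    by (intro measurable_completion) simp
  thus "(\<lambda>x. f x * bump (1 / \<rho>\<^sup>2) 0 x) \<in> borel_measurable lebesgue"
    using assms(1) unfolding L2_space_def by (auto intro: borel_measurable_times)
  show "AE x in lebesgue. norm (f x * bump (1 / \<rho>\<^sup>2) 0 x) \<le> norm ((f x)\<^sup>2 + indicator (ball 0 \<rho>) x)"
  proof (intro AE_I2)
    fix x :: 'a
    have "norm (f x * bump (1 / \<rho>\<^sup>2) 0 x) \<le> (f x)\<^sup>2 + indicator (ball 0 \<rho>) x"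
    proof (cases "norm x < \<rho>")
      case True
      have "\<bar>f x\<bar> * bump (1 / \<rho>\<^sup>2) 0 x \<le> \<bar>f x\<bar> * 1"
        by (intro mult_left_mono bump_0_le_1) auto
      also have "\<dots> \<le> (f x)\<^sup>2 + 1"
        using zero_le_power2[of "\<bar>f x\<bar> - 1"] by (simp add: power2_diff)
      finally show ?thesis using True by (simp add: abs_mult bump_nonneg)
    qed (simp add: bump_eq_0[OF assms(2)])
    thus "norm (f x * bump (1 / \<rho>\<^sup>2) 0 x) \<le> norm ((f x)\<^sup>2 + indicator (ball 0 \<rho>) x)" by simp
  qed
qed

lemma integrable_powr_times_bump:
  assumes u: "u \<in> Lp_loc p (spacetime T)" and \<rho>: "0 < \<rho>" "\<rho> < T"
  shows "integrable lebesgue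
    (\<lambda>z::real \<times> 'a::euclidean_space. indicator (spacetime T) z * (\<bar>u z\<bar> powr p * bump (1 / \<rho>\<^sup>2) 0 z))"
proof (rule Bochner_Integration.integrable_bound)
  let ?K = "({0..} \<times> UNIV) \<inter> cball 0 \<rho> :: (real \<times> 'a) set"
  have "compact ?K" by (intro closed_Int_compact closed_Times) auto
  moreover have K: "?K \<subseteq> spacetime T"
    using \<rho>(2) by (rule half_cball_subset_spacetime)
  ultimately have int: "integrable lebesgue (\<lambda>z. indicator ?K z * \<bar>u z\<bar> powr p)"
    using u by (simp add: Lp_loc_def set_integrable_def)
  thus "integrable lebesgue (\<lambda>z. indicator ?K z * \<bar>u z\<bar> powr p)" .
  \<comment> \<open>Passing to the compact half ball gives both measurability and the majorant from
    the \<open>Lp_loc\<close> condition.\<close>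
  have eq: "indicator (spacetime T) z * (\<bar>u z\<bar> powr p * bump (1 / \<rho>\<^sup>2) 0 z) =
      (indicator ?K z * \<bar>u z\<bar> powr p) * bump (1 / \<rho>\<^sup>2) 0 z" for z
    using bump_eq_0[OF \<rho>(1), of z 0] K by (cases "norm z < \<rho>") (auto simp: indicator_def)
  have "bump (1 / \<rho>\<^sup>2) 0 \<in> borel_measurable (lebesgue :: (real \<times> 'a) measure)"
    by (intro measurable_completion) simp
  thus "(\<lambda>z. indicator (spacetime T) z * (\<bar>u z\<bar> powr p * bump (1 / \<rho>\<^sup>2) 0 z))
      \<in> borel_measurable lebesgue"
    unfolding eq by (rule borel_measurable_times[OF borel_measurable_integrable[OF int]])
  show "AE z in lebesgue. norm (indicator (spacetime T) z * (\<bar>u z\<bar> powr p * bump (1 / \<rho>\<^sup>2) 0 z))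
      \<le> norm (indicator ?K z * \<bar>u z\<bar> powr p)"
  proof (intro AE_I2)
    fix z :: "real \<times> 'a"
    show "norm (indicator (spacetime T) z * (\<bar>u z\<bar> powr p * bump (1 / \<rho>\<^sup>2) 0 z))
      \<le> norm (indicator ?K z * \<bar>u z\<bar> powr p)"
      unfolding eq norm_mult using bump_0_le_1[of "1 / \<rho>\<^sup>2" z] bump_nonneg[of "1 / \<rho>\<^sup>2" 0 z]
      by (intro mult_left_le) auto
  qed
qed

section \<open>Upper and lower bounds for the data\<close>

text \<open>After multiplication by \<open>\<sigma>\<close> the nonlinear term is the integral of
  \<open>\<bar>u\<bar> powr p\<close> against the bump. Young's inequality bounds the other side by
  the same finite integral plus a constant times the volume of the spacetime ball, so
  \<open>u\<close> cancels.\<close>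

lemma weak_solution_data_bound:
  fixes u0 u1 :: "'a::euclidean_space \<Rightarrow> real"
  assumes sol: "weak_solution p b N u0 u1 T u"
    and N: "\<And>z. N z = \<sigma> * \<bar>z\<bar> powr p" "\<sigma> = 1 \<or> \<sigma> = -1"
    and p: "p > 1" and \<rho>: "0 < \<rho>" "\<rho> < T" and A: "A \<ge> 0"
    and bound: "\<And>z :: real \<times> 'a. z \<in> spacetime T \<Longrightarrow>
      \<bar>adjoint_op T b (bump (1 / \<rho>\<^sup>2) 0) z\<bar> \<le> A * bump (1 / \<rho>\<^sup>2) 0 z powr (1 / p)"
  shows "(LINT x|lebesgue. \<sigma> * (b 0 * u0 x + u1 x) * bump (1 / \<rho>\<^sup>2) 0 x)
    \<le> A powr (p / (p - 1)) * (unit_ball_vol (DIM('a) + 1) * \<rho> ^ (DIM('a) + 1))"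
proof -
  let ?S = "spacetime T :: (real \<times> 'a) set"
  let ?\<psi> = "bump (1 / \<rho>\<^sup>2) 0 :: real \<times> 'a \<Rightarrow> real"
  let ?q = "p / (p - 1)"
  \<comment> \<open>The point \<open>(0, x)\<close> is orthogonal to the time direction, so the
    factor \<open>z \<bullet> v\<close> of the derivative is 0.\<close>
  have dt0: "time_deriv T ?\<psi> (0, x) = 0" for x
    unfolding time_deriv_def using \<rho> by (subst dir_deriv_bump) auto
  have \<psi>0: "?\<psi> (0, x) = bump (1 / \<rho>\<^sup>2) 0 x" for x by (simp add: bump_def)
  let ?I = "LINT z:?S|lebesgue. \<bar>u z\<bar> powr p * ?\<psi> z"
  have int: "integrable lebesgue (\<lambda>z. indicator ?S z * (\<bar>u z\<bar> powr p * ?\<psi> z))"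
    using sol \<rho> by (intro integrable_powr_times_bump) (auto simp: weak_solution_def)
  have int': "integrable lebesgue (\<lambda>z::real \<times> 'a. indicator (ball 0 \<rho>) z * A powr ?q)"
    by (intro integrable_mult_left integrable_real_indicator)
      (auto simp: emeasure_ball \<rho> less_imp_le)
  txt \<open>The left-hand side need not be known to be integrable: otherwise its integral is \<open>0\<close> and the
    bound by a nonnegative function still holds.\<close>
  have "\<sigma> * (LINT z:?S|lebesgue. u z * adjoint_op T b ?\<psi> z)
      = (LINT z|lebesgue. indicator ?S z * (\<sigma> * u z * adjoint_op T b ?\<psi> z))"
    unfolding set_lebesgue_integral_def by (subst integral_mult_right_zero[symmetric]) (simp add: mult_ac)
  also have "\<dots> \<le> (LINT z|lebesgue. indicator ?S z * (\<bar>u z\<bar> powr p * ?\<psi> z)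
      + indicator (ball 0 \<rho>) z * A powr ?q)"
  proof (rule integral_mono')
    show "integrable lebesgue (\<lambda>z. indicator ?S z * (\<bar>u z\<bar> powr p * ?\<psi> z)
      + indicator (ball 0 \<rho>) z * A powr ?q)"
      using int int' by (rule Bochner_Integration.integrable_add)
  next
    fix z :: "real \<times> 'a"
    show "0 \<le> indicator ?S z * (\<bar>u z\<bar> powr p * ?\<psi> z) + indicator (ball 0 \<rho>) z * A powr ?q"
      by (intro add_nonneg_nonneg mult_nonneg_nonneg bump_nonneg) auto
    show "indicator ?S z * (\<sigma> * u z * adjoint_op T b ?\<psi> z)
      \<le> indicator ?S z * (\<bar>u z\<bar> powr p * ?\<psi> z) + indicator (ball 0 \<rho>) z * A powr ?q"
    proof (cases "z \<in> ?S")
      case True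
      have \<sigma>u: "\<bar>\<sigma> * u z\<bar> = \<bar>u z\<bar>" using N(2) by auto
      show ?thesis
      proof (cases "norm z < \<rho>")
        case False
        hence "?\<psi> z = 0" using bump_eq_0[OF \<rho>(1), of z] by simp
        \<comment> \<open>Since \<open>0 powr (1 / p) = 0\<close>, the assumed bound forces
          this.\<close>
        hence "adjoint_op T b ?\<psi> z = 0" using bound[OF True] p by simp
        thus ?thesis using \<open>?\<psi> z = 0\<close> by simp
      next
        case ball: True
        show ?thesis
          using Young_absorb[OF p A bump_nonneg bound[OF True], of "\<sigma> * u z"] True ball
          unfolding \<sigma>u by simp
      qed
    qed simp
  qed
  also have "\<dots> = ?I + A powr ?q * measure lborel (ball (0 :: real \<times> 'a) \<rho>)"
    using int int' by (simp add: set_lebesgue_integral_def mult_ac)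
  finally have up: "\<sigma> * (LINT z:?S|lebesgue. u z * adjoint_op T b ?\<psi> z)
      \<le> ?I + A powr ?q * measure lborel (ball (0 :: real \<times> 'a) \<rho>)" .
  have "(LINT z:?S|lebesgue. u z * adjoint_op T b ?\<psi> z) =
      (LINT x|lebesgue. (b 0 * u0 x + u1 x) * ?\<psi> (0, x)) + (LINT z:?S|lebesgue. N (u z) * ?\<psi> z)"
    using bspec[OF conjunct2[OF sol[unfolded weak_solution_def]] bump_test_function[OF \<rho>, of 0]]
    by (simp add: dt0)
  also have "(LINT z:?S|lebesgue. N (u z) * ?\<psi> z) = \<sigma> * ?I"
    unfolding set_lebesgue_integral_def
    by (subst integral_mult_right_zero[symmetric]) (simp add: N(1) mult_ac)
  finally have "\<sigma> * (LINT z:?S|lebesgue. u z * adjoint_op T b ?\<psi> z) =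
      \<sigma> * (LINT x|lebesgue. (b 0 * u0 x + u1 x) * ?\<psi> (0, x)) + \<sigma> * \<sigma> * ?I"
    by (simp add: algebra_simps)
  also have "\<sigma> * (LINT x|lebesgue. (b 0 * u0 x + u1 x) * ?\<psi> (0, x)) =
      (LINT x|lebesgue. \<sigma> * (b 0 * u0 x + u1 x) * bump (1 / \<rho>\<^sup>2) 0 x)"
    unfolding \<psi>0 by (subst integral_mult_right_zero[symmetric]) (simp add: mult_ac)
  also have "\<sigma> * \<sigma> = 1" using N(2) by auto
  finally show ?thesis
    using up \<rho> by (simp add: content_ball)
qed

text \<open>The integrand is nonnegative almost everywhere, so it suffices to integrate over the
  ball of radius \<open>\<rho> / 2\<close>, where \<open>g\<close> is at least
  \<open>\<rho> powr (- k)\<close> almost everywhere.\<close>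

lemma data_lower_bound:
  fixes g :: "'a::euclidean_space \<Rightarrow> real"
  assumes int: "integrable lebesgue (\<lambda>x. g x * bump (1 / \<rho>\<^sup>2) 0 x)"
    and g: "AE x in lebesgue. g x \<ge> (if norm x \<le> 1 then norm x powr (- k) else 0)"
    and "0 < \<rho>" "\<rho> \<le> 1" "k > 0"
  shows "exp (- 4 / 3) * \<rho> powr (- k) * (unit_ball_vol (DIM('a)) * (\<rho> / 2) ^ DIM('a))
    \<le> (LINT x|lebesgue. g x * bump (1 / \<rho>\<^sup>2) 0 x)"
proof -
  let ?c = "exp (- 4 / 3) * \<rho> powr (- k)"
  have "?c * measure lborel (ball (0::'a) (\<rho> / 2)) = (LINT x|lebesgue. indicator (ball (0::'a) (\<rho> / 2)) x * ?c)"
    by (simp add: mult_ac)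
  also have "\<dots> \<le> (LINT x|lebesgue. g x * bump (1 / \<rho>\<^sup>2) 0 x)"
  proof (rule integral_mono_AE'[OF int])
    \<comment> \<open>The origin must be excluded: there \<open>norm x powr (- k)\<close> has the
      default value 0 instead of being large.\<close>
    have "AE x in lebesgue. x \<noteq> (0 :: 'a)"
      by (intro AE_I'[of "{0}"]) (auto simp: negligible_iff_null_sets[symmetric])
    thus "AE x in lebesgue. indicator (ball 0 (\<rho> / 2)) x * ?c \<le> g x * bump (1 / \<rho>\<^sup>2) 0 x"
      using g
    proof eventually_elim
      case (elim x)
      have "0 \<le> g x" using elim(2) by (smt (verit) powr_ge_zero)
      show ?case
      proof (cases "norm x < \<rho> / 2")
        case True
        have "\<rho> powr (- k) \<le> norm x powr (- k)"
          using True elim(1) assms(3-5) by (intro powr_mono2') auto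
        also have "\<dots> \<le> g x" using elim(2) True assms(3,4) by simp
        finally have "\<rho> powr (- k) * exp (- 4 / 3) \<le> g x * bump (1 / \<rho>\<^sup>2) 0 x"
          using bump_0_lower_bound[OF assms(3) True] \<open>0 \<le> g x\<close> by (intro mult_mono) auto
        thus ?thesis using True by (simp add: mult_ac)
      qed (use \<open>0 \<le> g x\<close> in \<open>simp add: bump_nonneg\<close>)
    qed
    show "AE x in lebesgue. 0 \<le> g x * bump (1 / \<rho>\<^sup>2) 0 x"
      using g
    proof eventually_elim
      case (elim x)
      hence "0 \<le> g x" by (smt (verit) powr_ge_zero)
      thus ?case by (simp add: bump_nonneg)
    qed
  qed
  finally show ?thesis using assms(3) by (simp add: content_ball)
qed

section \<open>Comparison of the two bounds as the radius shrinks\<close>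

theorem theorem1p5:
  fixes b :: "real \<Rightarrow> real" and p k T \<sigma> :: real and N :: "real \<Rightarrow> real"
    and u0 u1 :: "real ^ 'n \<Rightarrow> real"
  assumes "CARD('n) \<ge> 3"
    and "\<And>t. t \<ge> 0 \<Longrightarrow> b t > 0"
    and "Ck_on 1 {0..} b"
    and "p > 1 + 4 / (real CARD('n) - 2)"
    and "\<sigma> = 1 \<or> \<sigma> = -1"
    and "\<And>z. N z = \<sigma> * \<bar>z\<bar> powr p"
    and "u0 \<in> H1_space" and "u1 \<in> L2_space"
    and "(p + 1) / (p - 1) < k" and "k < real CARD('n) / 2"
    and "AE x in lebesgue.
           \<sigma> * (b 0 * u0 x + u1 x) \<ge> (if norm x \<le> 1 then norm x powr (- k) else 0)"
    and "T > 0"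
  shows "\<not> (\<exists>u. weak_solution p b N u0 u1 T u)"
proof
  assume "\<exists>u. weak_solution p b N u0 u1 T u"
  then obtain u where sol: "weak_solution p b N u0 u1 T u" by blast
  let ?n = "CARD('n)"
  define q where "q = p / (p - 1)"
  have "4 / (real ?n - 2) > 0" using assms(1) by simp
  hence p: "p > 1" using assms(4) by linarith
  \<comment> \<open>The lower bound on \<open>k\<close> thus says that \<open>k + 1 - 2 * q\<close>,
    the power of \<open>\<rho>\<close> left over in the comparison, is positive.\<close>
  have "(p + 1) / (p - 1) = 2 * q - 1" using p by (simp add: q_def field_simps)
  hence kq: "k + 1 - 2 * q > 0" using assms(9) by simp
  have "(p + 1) / (p - 1) > 0" using p by simp
  hence k: "k > 0" using assms(9) by linarith
  obtain B where B: "B \<ge> 0" "\<And>t. t \<in> {0..1} \<Longrightarrow> \<bar>b t\<bar> \<le> B"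
      "\<And>t. t \<in> {0..1} \<Longrightarrow> \<bar>deriv_coeff b t\<bar> \<le> B"
    using C1_coefficient_bounds[OF assms(3)] by blast
  define M where "M = (14 + 14 * real ?n + 3 * B) * (4 / (1 - 1 / p)) ^ 4"
  have M: "M \<ge> 0" using B(1) p unfolding M_def by (intro mult_nonneg_nonneg) auto
  define L where "L = exp (- 4 / 3) * (unit_ball_vol ?n / 2 ^ ?n)"
  define R where "R = M powr q * unit_ball_vol (?n + 1)"
  \<comment> \<open>Here \<open>\<rho> < 1\<close> is for the coefficient and data bounds,
    \<open>\<rho> < T\<close> for the support. The common factor \<open>\<rho> ^ ?n\<close> cancels,
    and one further power of \<open>\<rho>\<close> comes from the time dimension.\<close>
  have "L \<le> R * \<rho> powr (k + 1 - 2 * q)" if \<rho>: "0 < \<rho>" "\<rho> < min 1 T" for \<rho>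
  proof -
    have "u0 \<in> L2_space" using assms(7) by (simp add: H1_space_def)
    hence "integrable lebesgue (\<lambda>x. b 0 * (u0 x * bump (1 / \<rho>\<^sup>2) 0 x) + u1 x * bump (1 / \<rho>\<^sup>2) 0 x)"
      using assms(8) \<rho> by (intro Bochner_Integration.integrable_add integrable_mult_right
          integrable_L2_times_bump)
    hence "integrable lebesgue
        (\<lambda>x. \<sigma> * (b 0 * (u0 x * bump (1 / \<rho>\<^sup>2) 0 x) + u1 x * bump (1 / \<rho>\<^sup>2) 0 x))"
      by (rule integrable_mult_right)
    hence int: "integrable lebesgue (\<lambda>x. \<sigma> * (b 0 * u0 x + u1 x) * bump (1 / \<rho>\<^sup>2) 0 x)"
      by (simp add: algebra_simps)
    have "\<bar>adjoint_op T b (bump (1 / \<rho>\<^sup>2) 0) z\<bar> \<le> M / \<rho>\<^sup>2 * bump (1 / \<rho>\<^sup>2) 0 z powr (1 / p)"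
      if "z \<in> spacetime T" for z :: "real \<times> (real ^ 'n)"
      using adjoint_op_bump_bound[OF _ _ _ _ that B(1), of \<rho> "1 / p" b] B \<rho> p by (simp add: M_def)
    hence upper: "(LINT x|lebesgue. \<sigma> * (b 0 * u0 x + u1 x) * bump (1 / \<rho>\<^sup>2) 0 x)
        \<le> (M / \<rho>\<^sup>2) powr q * (unit_ball_vol (?n + 1) * \<rho> ^ (?n + 1))"
      using weak_solution_data_bound[OF sol assms(6,5) p, of \<rho> "M / \<rho>\<^sup>2"] M \<rho> by (simp add: q_def)
    have "exp (- 4 / 3) * \<rho> powr (- k) * (unit_ball_vol ?n * (\<rho> / 2) ^ ?n)
        \<le> (LINT x|lebesgue. \<sigma> * (b 0 * u0 x + u1 x) * bump (1 / \<rho>\<^sup>2) 0 x)"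
      using data_lower_bound[OF int assms(11)] k \<rho> by simp
    also note upper
    also have "(M / \<rho>\<^sup>2) powr q = M powr q * \<rho> powr (- 2 * q)"
      using \<rho> M powr_powr[of \<rho> 2 q] by (simp add: powr_divide powr_minus field_simps)
    finally have "\<rho> powr (- k) * (\<rho> ^ ?n * L) \<le> \<rho> powr (- 2 * q) * \<rho> * (\<rho> ^ ?n * R)"
      by (simp add: L_def R_def power_divide mult_ac)
    hence "\<rho> ^ ?n * (\<rho> powr (- k) * L) \<le> \<rho> ^ ?n * (\<rho> powr (1 - 2 * q) * R)"
      using \<rho> by (simp add: powr_diff powr_minus field_simps)
    hence "\<rho> powr (- k) * L \<le> \<rho> powr (1 - 2 * q) * R"
      using \<rho> by (simp add: mult_le_cancel_left_pos)
    hence "\<rho> powr k * (\<rho> powr (- k) * L) \<le> \<rho> powr k * (\<rho> powr (1 - 2 * q) * R)"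
      by (rule mult_left_mono) simp
    thus ?thesis
      using \<rho> by (simp flip: mult.assoc powr_add) (simp add: algebra_simps)
  qed
  \<comment> \<open>As \<open>\<rho>\<close> tends to 0 from the right, the right-hand side tends to
    0, whereas \<open>L\<close> is a fixed positive number.\<close>
  hence "eventually (\<lambda>\<rho>. L \<le> R * \<rho> powr (k + 1 - 2 * q)) (at_right 0)"
    using assms(12) unfolding eventually_at_right_field by (intro exI[of _ "min 1 T"]) auto
  moreover have "((\<lambda>\<rho>. R * \<rho> powr (k + 1 - 2 * q)) \<longlongrightarrow> R * 0) (at_right 0)"
    using kq by (intro tendsto_mult tendsto_const tendsto_zero_powrI[OF tendsto_ident_at tendsto_const])
      (auto simp: eventually_at_right_field intro: exI[of _ 1])
  ultimately have "L \<le> R * 0"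
    by (intro tendsto_lowerbound) auto
  moreover have "L > 0" by (simp add: L_def unit_ball_vol_pos)
  ultimately show False by simp
qed

end
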